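(* Let $h\colon\mathcal{X}\to\mathcal{Y}$ be a classifier with conditional risk $r(x)=\sum_{y\in\mathcal{Y}}p(y\mid x)\,\ell(y,h(x))$, and let $0<\omega\le 1$ be a target coverage. Consider the problem $$\min_{c\in[0,1]^{\mathcal{X}}}\ R_S(h,c)\quad\text{s.t.}\quad\phi(c)\ge\omega, \qquad (Q)$$ where it is assumed that the minimizer exists. Let $$\beta=\inf\Big\{a\ \Big|\ \int_{\mathcal{X}_{r(x)<a}}p(x)\,dx\ge\omega\Big\}.$$ Then a selection function $c^*\colon\mathcal{X}\to[0,1]$ is an optimal solution to $(Q)$ if and only if $$\int_{\mathcal{X}_{r(x)<\beta}}p(x)c^*(x)\,dx=\int_{\mathcal{X}_{r(x)<\beta}}p(x)\,dx,$$ $$\int_{\mathcal{X}_{r(x)=\beta}}p(x)c^*(x)\,dx=\omega-\int_{\mathcal{X}_{r(x)<\beta}}p(x)\,dx,$$ $$\int_{\mathcal{X}_{r(x)>\beta}}p(x)c^*(x)\,dx=0 .$$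
   Context: $\mathcal{X}$ is a set of inputs (a measurable space with a fixed reference measure $dx$), $\mathcal{Y}$ is a finite set of labels, $p(x,y)$ is a probability density on $\mathcal{X}\times\mathcal{Y}$ (with respect to $dx$ times counting measure), $p(x)=\sum_{y\in\mathcal{Y}}p(x,y)$ is its marginal, and $p(y\mid x)$ is the conditional distribution, so $p(x,y)=p(x)p(y\mid x)$. $\ell\colon\mathcal{Y}\times\mathcal{Y}\to[0,\infty)$ is a loss. A classifier is a function $h\colon\mathcal{X}\to\mathcal{Y}$, a selection function is a function $c\colon\mathcal{X}\to[0,1]$; all functions and sets are taken measurable. The coverage of $c$ is $\phi(c)=\int_{\mathcal{X}}p(x)c(x)\,dx$, and the selective risk of $(h,c)$ is $$R_S(h,c)=\frac{\int_{\mathcal{X}}\sum_{y\in\mathcal{Y}}p(x,y)\,\ell(y,h(x))\,c(x)\,dx}{\phi(c)},$$ defined when $\phi(c)\neq 0$. For $f\colon\mathcal{X}\to\mathbb{R}$ and $a\in\mathbb{R}$, $\mathcal{X}_{f(x)<a}=\{x\in\mathcal{X}\mid f(x)<a\}$, and similarly for $\le,=,>,\ge$.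
   Formalization: The "only if" direction is proved only when the mass of {r<β} is positive or the mass of {r=β} is at most ω; otherwise it is false (e.g. zero loss, ω=1/2, c*=1 is optimal but violates the second equation). The "if" direction holds without this condition. *)

theory Defs
  imports "HOL-Probability.Probability"
begin

text \<open>
  Inputs are the points of the reference measure space \<open>M\<close> (\<open>dx\<close>); labels are a finite type.
\<close>

definition joint_density :: "'x measure \<Rightarrow> ('x \<Rightarrow> 'y::finite \<Rightarrow> real) \<Rightarrow> bool" where
  "joint_density M p \<longleftrightarrow>
     (\<lambda>(x, y). p x y) \<in> borel_measurable (M \<Otimes>\<^sub>M count_space UNIV) \<and>
     (\<forall>x\<in>space M. \<forall>y. 0 \<le> p x y) \<and>
     prob_space (density (M \<Otimes>\<^sub>M count_space UNIV) (\<lambda>(x, y). ennreal (p x y)))"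

definition marginal :: "('x \<Rightarrow> 'y::finite \<Rightarrow> real) \<Rightarrow> 'x \<Rightarrow> real" where
  "marginal p x = (\<Sum>y\<in>UNIV. p x y)"

text \<open>
  Any version of the conditional distribution is admitted: where the marginal vanishes,
  \<open>q x\<close> may be an arbitrary (measurably chosen) distribution on the labels.
\<close>

definition conditional_distribution ::
  "'x measure \<Rightarrow> ('x \<Rightarrow> 'y::finite \<Rightarrow> real) \<Rightarrow> ('x \<Rightarrow> 'y \<Rightarrow> real) \<Rightarrow> bool" where
  "conditional_distribution M p q \<longleftrightarrow>
     (\<lambda>(x, y). q x y) \<in> borel_measurable (M \<Otimes>\<^sub>M count_space UNIV) \<and>
     (\<forall>x\<in>space M. (\<forall>y. 0 \<le> q x y) \<and> (\<Sum>y\<in>UNIV. q x y) = 1 \<and>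
        (\<forall>y. p x y = marginal p x * q x y))"

definition selection_function :: "'x measure \<Rightarrow> ('x \<Rightarrow> real) \<Rightarrow> bool" where
  "selection_function M c \<longleftrightarrow>
     c \<in> borel_measurable M \<and> (\<forall>x\<in>space M. 0 \<le> c x \<and> c x \<le> 1)"

definition coverage :: "'x measure \<Rightarrow> ('x \<Rightarrow> 'y::finite \<Rightarrow> real) \<Rightarrow> ('x \<Rightarrow> real) \<Rightarrow> real" where
  "coverage M p c = (LINT x|M. marginal p x * c x)"

text \<open>Only meaningful at nonzero coverage, which feasibility below guarantees for positive targets.\<close>

definition selective_risk ::
  "'x measure \<Rightarrow> ('x \<Rightarrow> 'y::finite \<Rightarrow> real) \<Rightarrow> ('y \<Rightarrow> 'y \<Rightarrow> real) \<Rightarrow> ('x \<Rightarrow> 'y) \<Rightarrow> ('x \<Rightarrow> real) \<Rightarrow> real"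
where
  "selective_risk M p l h c =
     (LINT x|M. (\<Sum>y\<in>UNIV. p x y * l y (h x) * c x)) / coverage M p c"

definition conditional_risk ::
  "('x \<Rightarrow> 'y::finite \<Rightarrow> real) \<Rightarrow> ('y \<Rightarrow> 'y \<Rightarrow> real) \<Rightarrow> ('x \<Rightarrow> 'y) \<Rightarrow> 'x \<Rightarrow> real" where
  "conditional_risk q l h x = (\<Sum>y\<in>UNIV. q x y * l y (h x))"

definition feasible ::
  "'x measure \<Rightarrow> ('x \<Rightarrow> 'y::finite \<Rightarrow> real) \<Rightarrow> real \<Rightarrow> ('x \<Rightarrow> real) \<Rightarrow> bool" where
  "feasible M p \<omega> c \<longleftrightarrow> selection_function M c \<and> \<omega> \<le> coverage M p c"

definition optimal_selection ::
  "'x measure \<Rightarrow> ('x \<Rightarrow> 'y::finite \<Rightarrow> real) \<Rightarrow> ('y \<Rightarrow> 'y \<Rightarrow> real) \<Rightarrow> ('x \<Rightarrow> 'y) \<Rightarrow> real \<Rightarrow>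
     ('x \<Rightarrow> real) \<Rightarrow> bool"
where
  "optimal_selection M p l h \<omega> c \<longleftrightarrow> is_arg_min (selective_risk M p l h) (feasible M p \<omega>) c"

definition risk_threshold ::
  "'x measure \<Rightarrow> ('x \<Rightarrow> 'y::finite \<Rightarrow> real) \<Rightarrow> ('x \<Rightarrow> real) \<Rightarrow> real \<Rightarrow> real" where
  "risk_threshold M p r \<omega> = Inf {a. \<omega> \<le> (LINT x:{x \<in> space M. r x < a}|M. marginal p x)}"

text \<open>
  These equations force coverage exactly \<open>\<omega>\<close>. If no probability mass lies strictly below \<open>\<beta>\<close>,
  selecting more of the level set \<open>r = \<beta>\<close> leaves the selective risk unchanged, so an optimal
  selection function can then violate the second equation whenever the level set carries mass
  exceeding \<open>\<omega>\<close>.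
\<close>

definition threshold_equations ::
  "'x measure \<Rightarrow> ('x \<Rightarrow> 'y::finite \<Rightarrow> real) \<Rightarrow> ('x \<Rightarrow> real) \<Rightarrow> real \<Rightarrow> real \<Rightarrow>
     ('x \<Rightarrow> real) \<Rightarrow> bool"
where
  "threshold_equations M p r \<omega> \<beta> c \<longleftrightarrow>
     (LINT x:{x \<in> space M. r x < \<beta>}|M. marginal p x * c x) =
       (LINT x:{x \<in> space M. r x < \<beta>}|M. marginal p x) \<and>
     (LINT x:{x \<in> space M. r x = \<beta>}|M. marginal p x * c x) =
       \<omega> - (LINT x:{x \<in> space M. r x < \<beta>}|M. marginal p x) \<and>
     (LINT x:{x \<in> space M. r x > \<beta>}|M. marginal p x * c x) = 0"

end

theory Submission
  imports Defs
begin

text \<open>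
  Integrate against the probability measure \<open>P\<close> with density \<open>p(x)\<close>, and write \<open>\<phi> = E c\<close>,
  \<open>D = E (\<beta> - r)\<^sup>+\<close>. Splitting \<open>r - \<beta>\<close> into positive and negative part gives
  \<open>E (r c) = \<beta> \<phi> - D + g\<close>, where \<open>g = E ((r - \<beta>)\<^sup>+ c + (\<beta> - r)\<^sup>+ (1 - c)) \<ge> 0\<close> vanishes exactly
  when \<open>c\<close> is almost surely \<open>1\<close> below and \<open>0\<close> above the threshold. Hence
  \<open>E (r c) / \<phi> = \<beta> - D / \<phi> + g / \<phi> \<ge> \<beta> - D / \<omega>\<close> whenever \<open>\<phi> \<ge> \<omega>\<close>, with equality iff \<open>g = 0\<close>
  and \<open>D (\<phi> - \<omega>) = 0\<close>. The quantile property of \<open>\<beta>\<close> makes the bound attainable, and the two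
  alternatives in the theorem are what excludes \<open>\<phi> > \<omega>\<close> at an optimum.
\<close>

section \<open>Quantiles of the risk\<close>

text \<open>The admissible levels form an upward closed set, so all levels below
  \<open>\<beta>\<close> fail and all levels above it succeed. Continuity of the measure along
  \<open>\<beta> - 1 / Suc n\<close> and \<open>\<beta> + 1 / Suc n\<close> carries this to
  \<open>\<beta>\<close> itself. The bounds on \<open>r\<close> make the set nonempty and bounded
  below, so that \<open>Inf\<close> is a genuine infimum.\<close>

lemma (in prob_space) quantile_threshold:
  fixes r :: "'a \<Rightarrow> real"
  assumes [measurable]: "r \<in> borel_measurable M"
    and r: "\<And>x. x \<in> space M \<Longrightarrow> A \<le> r x \<and> r x \<le> B"
    and \<omega>: "0 < \<omega>" "\<omega> \<le> 1"
    and \<beta>: "\<beta> = Inf {a. \<omega> \<le> prob {x \<in> space M. r x < a}}"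
  shows "prob {x \<in> space M. r x < \<beta>} \<le> \<omega>" "\<omega> \<le> prob {x \<in> space M. r x \<le> \<beta>}"
proof -
  define S where "S = {a. \<omega> \<le> prob {x \<in> space M. r x < a}}"
  \<comment> \<open>Sublevel sets are strict and \<open>r\<close> may attain \<open>B\<close>, hence
    the \<open>+ 1\<close>.\<close>
  have "B + 1 \<in> S"
  proof -
    have "{x \<in> space M. r x < B + 1} = space M" using r by force
    then show ?thesis using \<omega> by (simp add: S_def prob_space)
  qed
  then have ne: "S \<noteq> {}" by blast
  have "A \<le> a" if "a \<in> S" for a
  proof (rule ccontr)
    assume "\<not> A \<le> a"
    then have "{x \<in> space M. r x < a} = {}" using r by force
    then show False using that \<omega> by (simp add: S_def del: Collect_empty_eq)
  qed
  then have bdd: "bdd_below S" by (rule bdd_belowI)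
  have up: "b \<in> S" if "a \<in> S" "a \<le> b" for a b
  proof -
    have "prob {x \<in> space M. r x < a} \<le> prob {x \<in> space M. r x < b}"
      using that by (intro finite_measure_mono) auto
    then show ?thesis using that by (simp add: S_def)
  qed
  have below: "a \<notin> S" if "a < \<beta>" for a
    using that cInf_lower[OF _ bdd, of a] \<beta> by (auto simp: S_def)
  have above: "a \<in> S" if "\<beta> < a" for a
    using that up cInf_lessD[OF ne, of a] \<beta> by (fastforce simp: S_def)
  have "(\<lambda>n. prob {x \<in> space M. r x < \<beta> - 1 / Suc n}) \<longlonglongrightarrow>
      prob (\<Union>n. {x \<in> space M. r x < \<beta> - 1 / Suc n})"
  proof (rule finite_Lim_measure_incseq)
    show "incseq (\<lambda>n. {x \<in> space M. r x < \<beta> - 1 / Suc n})"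
    proof (rule incseq_SucI, safe)
      fix n x assume "r x < \<beta> - 1 / real (Suc n)"
      moreover have "1 / real (Suc (Suc n)) \<le> 1 / real (Suc n)" by (simp add: field_simps)
      ultimately show "r x < \<beta> - 1 / real (Suc (Suc n))" by linarith
    qed
  qed auto
  moreover have "(\<Union>n. {x \<in> space M. r x < \<beta> - 1 / Suc n}) = {x \<in> space M. r x < \<beta>}"
  proof safe
    fix x n assume "r x < \<beta> - 1 / real (Suc n)"
    moreover have "0 < 1 / real (Suc n)" by simp
    ultimately show "r x < \<beta>" by linarith
  next
    fix x assume "x \<in> space M" "r x < \<beta>"
    moreover from this obtain n where "inverse (real (Suc n)) < \<beta> - r x"
      using reals_Archimedean[of "\<beta> - r x"] by auto
    ultimately show "x \<in> (\<Union>n. {x \<in> space M. r x < \<beta> - 1 / Suc n})"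
      by (auto simp: inverse_eq_divide intro!: exI[of _ n])
  qed
  ultimately have "(\<lambda>n. prob {x \<in> space M. r x < \<beta> - 1 / Suc n}) \<longlonglongrightarrow> prob {x \<in> space M. r x < \<beta>}"
    by simp
  \<comment> \<open>Strict for each \<open>n\<close>, but only the weak inequality survives the
    limit.\<close>
  moreover have "prob {x \<in> space M. r x < \<beta> - 1 / Suc n} \<le> \<omega>" for n
    using below[of "\<beta> - 1 / Suc n"] by (simp add: S_def)
  ultimately show "prob {x \<in> space M. r x < \<beta>} \<le> \<omega>"
    by (intro LIMSEQ_le_const2) auto
  have "(\<lambda>n. prob {x \<in> space M. r x < \<beta> + 1 / Suc n}) \<longlonglongrightarrow>
      prob (\<Inter>n. {x \<in> space M. r x < \<beta> + 1 / Suc n})"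
  proof (rule finite_Lim_measure_decseq)
    show "decseq (\<lambda>n. {x \<in> space M. r x < \<beta> + 1 / Suc n})"
    proof (rule decseq_SucI, safe)
      fix n x assume "r x < \<beta> + 1 / real (Suc (Suc n))"
      moreover have "1 / real (Suc (Suc n)) \<le> 1 / real (Suc n)" by (simp add: field_simps)
      ultimately show "r x < \<beta> + 1 / real (Suc n)" by linarith
    qed
  qed auto
  moreover have "(\<Inter>n. {x \<in> space M. r x < \<beta> + 1 / Suc n}) = {x \<in> space M. r x \<le> \<beta>}"
  proof (intro set_eqI iffI)
    fix x assume x: "x \<in> (\<Inter>n. {x \<in> space M. r x < \<beta> + 1 / Suc n})"
    have "r x \<le> \<beta>"
    proof (rule ccontr)
      assume "\<not> r x \<le> \<beta>"
      then obtain n where "inverse (real (Suc n)) < r x - \<beta>"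
        using reals_Archimedean[of "r x - \<beta>"] by auto
      moreover have "r x < \<beta> + 1 / Suc n" using x by blast
      ultimately show False by (simp add: inverse_eq_divide)
    qed
    then show "x \<in> {x \<in> space M. r x \<le> \<beta>}" using x by blast
  next
    fix x assume "x \<in> {x \<in> space M. r x \<le> \<beta>}"
    moreover have "0 < 1 / real (Suc n)" for n by simp
    ultimately show "x \<in> (\<Inter>n. {x \<in> space M. r x < \<beta> + 1 / Suc n})"
      by (auto intro: le_less_trans simp del: of_nat_Suc)
  qed
  ultimately have "(\<lambda>n. prob {x \<in> space M. r x < \<beta> + 1 / Suc n}) \<longlonglongrightarrow> prob {x \<in> space M. r x \<le> \<beta>}"
    by simp
  moreover have "\<omega> \<le> prob {x \<in> space M. r x < \<beta> + 1 / Suc n}" for n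
    using above[of "\<beta> + 1 / Suc n"] by (simp add: S_def)
  ultimately show "\<omega> \<le> prob {x \<in> space M. r x \<le> \<beta>}"
    by (intro LIMSEQ_le_const) auto
qed

section \<open>The selection problem on a probability space\<close>

text \<open>The marginal density is absorbed into the measure, so coverage is a plain expectation.
  The threshold enters through the two mass bounds rather than as an infimum.\<close>

locale selection_threshold = prob_space +
  fixes r :: "'a \<Rightarrow> real" and \<omega> \<beta> :: real
  assumes integrable_risk: "integrable M r"
    and target_pos: "0 < \<omega>"
    and mass_below_le: "prob {x \<in> space M. r x < \<beta>} \<le> \<omega>"
    and mass_upto_ge: "\<omega> \<le> prob {x \<in> space M. r x \<le> \<beta>}"
begin

abbreviation "lower \<equiv> {x \<in> space M. r x < \<beta>}"
abbreviation "level \<equiv> {x \<in> space M. r x = \<beta>}"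
abbreviation "upper \<equiv> {x \<in> space M. r x > \<beta>}"

text \<open>The constant \<open>D\<close> of the overview.\<close>

definition saving :: real where
  "saving = expectation (\<lambda>x. max 0 (\<beta> - r x))"

text \<open>The quantity \<open>g\<close> of the overview: the first summand charges selection above
  the threshold, the second charges rejection below it.\<close>

definition waste :: "('a \<Rightarrow> real) \<Rightarrow> real" where
  "waste c = expectation (\<lambda>x. max 0 (r x - \<beta>) * c x + max 0 (\<beta> - r x) * (1 - c x))"

definition equations :: "('a \<Rightarrow> real) \<Rightarrow> bool" where
  "equations c \<longleftrightarrow>
     (LINT x:lower|M. c x) = prob lower \<and>
     (LINT x:level|M. c x) = \<omega> - prob lower \<and>
     (LINT x:upper|M. c x) = 0"

lemma measurable_risk [measurable]: "r \<in> borel_measurable M"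
  using integrable_risk by auto

lemma integrable_mult_selection:
  assumes "selection_function M c" "integrable M f"
  shows "integrable M (\<lambda>x. f x * c x)" "integrable M (\<lambda>x. f x * (1 - c x))"
proof -
  have [measurable]: "c \<in> borel_measurable M" "f \<in> borel_measurable M"
    and c: "\<And>x. x \<in> space M \<Longrightarrow> 0 \<le> c x \<and> c x \<le> 1"
    using assms by (auto simp: selection_function_def)
  show "integrable M (\<lambda>x. f x * c x)" "integrable M (\<lambda>x. f x * (1 - c x))"
    using c by (auto intro!: Bochner_Integration.integrable_bound[OF assms(2)] AE_I2
        simp: abs_mult mult_left_le)
qed

lemma integrable_selection: "selection_function M c \<Longrightarrow> integrable M c"
  using integrable_mult_selection(1)[of c "\<lambda>_. 1"] by simp

lemma integrable_waste:
  assumes "selection_function M c"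
  shows "integrable M (\<lambda>x. max 0 (r x - \<beta>) * c x + max 0 (\<beta> - r x) * (1 - c x))"
  using assms integrable_risk
  by (intro Bochner_Integration.integrable_add integrable_mult_selection integrable_max
      Bochner_Integration.integrable_diff) auto

lemma saving_nonneg: "0 \<le> saving"
  unfolding saving_def by (rule Bochner_Integration.integral_nonneg) auto

lemma waste_nonneg: "selection_function M c \<Longrightarrow> 0 \<le> waste c"
  unfolding waste_def
  by (rule Bochner_Integration.integral_nonneg) (auto simp: selection_function_def)

text \<open>Pointwise, write \<open>r - \<beta>\<close> as positive part minus negative part and
  replace \<open>c\<close> by \<open>1 - (1 - c)\<close> in the negative part.\<close>

lemma expectation_risk_selection:
  assumes "selection_function M c"
  shows "expectation (\<lambda>x. r x * c x) = \<beta> * expectation c - saving + waste c"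
proof -
  have "expectation (\<lambda>x. r x * c x) = expectation (\<lambda>x. (\<beta> * c x - max 0 (\<beta> - r x)) +
      (max 0 (r x - \<beta>) * c x + max 0 (\<beta> - r x) * (1 - c x)))"
    by (intro Bochner_Integration.integral_cong) (auto simp: max_def algebra_simps)
  also have "\<dots> = expectation (\<lambda>x. \<beta> * c x - max 0 (\<beta> - r x)) + waste c"
    unfolding waste_def using assms integrable_risk
    by (intro Bochner_Integration.integral_add integrable_waste
        Bochner_Integration.integrable_diff integrable_max) (auto intro: integrable_selection)
  also have "expectation (\<lambda>x. \<beta> * c x - max 0 (\<beta> - r x)) = \<beta> * expectation c - saving"
    unfolding saving_def using assms integrable_risk
    by (subst Bochner_Integration.integral_diff)
      (auto intro!: integrable_selection integrable_max)
  finally show ?thesis .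
qed

text \<open>A nonnegative integrand with integral zero vanishes almost everywhere. Off the level set
  one of the two coefficients is positive and fixes \<open>c\<close>; on the level set both are zero
  and \<open>c\<close> stays free.\<close>

lemma waste_eq_0_iff:
  assumes c: "selection_function M c"
  shows "waste c = 0 \<longleftrightarrow> (AE x in M. (r x < \<beta> \<longrightarrow> c x = 1) \<and> (r x > \<beta> \<longrightarrow> c x = 0))"
proof -
  have "waste c = 0 \<longleftrightarrow>
      (AE x in M. max 0 (r x - \<beta>) * c x + max 0 (\<beta> - r x) * (1 - c x) = 0)"
    unfolding waste_def using c
    by (intro integral_nonneg_eq_0_iff_AE integrable_waste)
      (auto simp: selection_function_def)
  also have "\<dots> \<longleftrightarrow> (AE x in M. (r x < \<beta> \<longrightarrow> c x = 1) \<and> (r x > \<beta> \<longrightarrow> c x = 0))"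
    by (intro AE_cong) (auto simp: max_def)
  finally show ?thesis .
qed

text \<open>The integrand is positive exactly on \<open>lower\<close>. This links the equality case
  of the risk bound to the first alternative of the theorem.\<close>

lemma saving_eq_0_iff: "saving = 0 \<longleftrightarrow> prob lower = 0"
proof -
  have "saving = 0 \<longleftrightarrow> (AE x in M. max 0 (\<beta> - r x) = 0)"
    unfolding saving_def using integrable_risk
    by (intro integral_nonneg_eq_0_iff_AE) auto
  also have "\<dots> \<longleftrightarrow> (AE x in M. x \<notin> lower)"
    by (intro AE_cong) (auto simp: max_def)
  also have "\<dots> \<longleftrightarrow> prob lower = 0"
    by (subst AE_iff_null_sets[symmetric]) (auto simp: null_sets_def emeasure_eq_measure)
  finally show ?thesis .
qed

lemma set_integrable_selection:
  assumes "selection_function M c" and [measurable]: "A \<in> sets M"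
  shows "set_integrable M A c"
  using integrable_mult_selection(1)[OF assms(1), of "indicator A"]
  by (simp add: set_integrable_def emeasure_eq_measure)

lemma expectation_split:
  assumes c: "selection_function M c"
  shows "expectation c = (LINT x:lower|M. c x) + (LINT x:level|M. c x) + (LINT x:upper|M. c x)"
proof -
  have "expectation c = (LINT x|M. indicator lower x * c x + indicator level x * c x +
      indicator upper x * c x)"
    by (intro Bochner_Integration.integral_cong) (auto simp: indicator_def)
  also have "\<dots> = (LINT x:lower|M. c x) + (LINT x:level|M. c x) + (LINT x:upper|M. c x)"
    using set_integrable_selection[OF c]
    by (simp add: set_integrable_def set_lebesgue_integral_def)
  finally show ?thesis .
qed

text \<open>Because \<open>0 \<le> c \<le> 1\<close>, the outer two equations force \<open>c\<close>
  almost surely to be \<open>1\<close> below and \<open>0\<close> above the threshold, which is zero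
  waste. Given these two, splitting the expectation turns the middle equation into exact
  coverage.\<close>

lemma equations_iff:
  assumes c: "selection_function M c"
  shows "equations c \<longleftrightarrow> waste c = 0 \<and> expectation c = \<omega>"
proof -
  have cb: "\<And>x. x \<in> space M \<Longrightarrow> 0 \<le> c x \<and> c x \<le> 1" using c by (simp add: selection_function_def)
  have "(LINT x:lower|M. c x) = prob lower \<longleftrightarrow> (LINT x|M. indicator lower x * (1 - c x)) = 0"
  proof -
    have "(LINT x|M. indicator lower x * (1 - c x)) = (LINT x|M. indicator lower x - indicator lower x * c x)"
      by (simp add: algebra_simps)
    also have "\<dots> = prob lower - (LINT x:lower|M. c x)"
      using set_integrable_selection[OF c, of lower]
      by (simp add: set_integrable_def set_lebesgue_integral_def emeasure_eq_measure)
    finally show ?thesis by auto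
  qed
  also have "\<dots> \<longleftrightarrow> (AE x in M. indicator lower x * (1 - c x) = 0)"
    using cb integrable_mult_selection(2)[OF c, of "indicator lower"]
    by (intro integral_nonneg_eq_0_iff_AE) (auto simp: emeasure_eq_measure)
  also have "\<dots> \<longleftrightarrow> (AE x in M. r x < \<beta> \<longrightarrow> c x = 1)"
    by (intro AE_cong) (auto simp: indicator_def)
  finally have 1: "(LINT x:lower|M. c x) = prob lower \<longleftrightarrow> \<dots>" .
  have "(LINT x:upper|M. c x) = 0 \<longleftrightarrow> (AE x in M. indicator upper x * c x = 0)"
    unfolding set_lebesgue_integral_def real_scaleR_def
    using cb integrable_mult_selection(1)[OF c, of "indicator upper"]
    by (intro integral_nonneg_eq_0_iff_AE) (auto simp: emeasure_eq_measure)
  also have "\<dots> \<longleftrightarrow> (AE x in M. r x > \<beta> \<longrightarrow> c x = 0)"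
    by (intro AE_cong) (auto simp: indicator_def)
  finally have 2: "(LINT x:upper|M. c x) = 0 \<longleftrightarrow> \<dots>" .
  show ?thesis
    unfolding equations_def waste_eq_0_iff[OF c] AE_conj_iff 1[symmetric] 2[symmetric]
    using expectation_split[OF c] by auto
qed

section \<open>The lower bound on the selective risk\<close>

text \<open>The excess over the bound is a sum of two nonnegative terms, one for waste and one for
  coverage beyond \<open>\<omega>\<close>. Equality therefore means that both vanish.\<close>

lemma risk_ratio_ge:
  assumes c: "selection_function M c" and cov: "\<omega> \<le> expectation c"
  shows "\<beta> - saving / \<omega> \<le> expectation (\<lambda>x. r x * c x) / expectation c"
    and "expectation (\<lambda>x. r x * c x) / expectation c = \<beta> - saving / \<omega> \<longleftrightarrow>
      waste c = 0 \<and> (saving = 0 \<or> expectation c = \<omega>)"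
proof -
  define \<phi> where "\<phi> = expectation c"
  have pos: "0 < \<phi>" "\<omega> \<le> \<phi>" using cov target_pos by (auto simp: \<phi>_def)
  have diff: "expectation (\<lambda>x. r x * c x) / \<phi> - (\<beta> - saving / \<omega>) =
      (waste c * \<omega> + saving * (\<phi> - \<omega>)) / (\<phi> * \<omega>)"
    using pos target_pos unfolding expectation_risk_selection[OF c] \<phi>_def[symmetric]
    by (simp add: field_simps)
  have w: "0 \<le> waste c * \<omega>" and s: "0 \<le> saving * (\<phi> - \<omega>)"
    using waste_nonneg[OF c] saving_nonneg pos target_pos by auto
  then have "0 \<le> (waste c * \<omega> + saving * (\<phi> - \<omega>)) / (\<phi> * \<omega>)"
    using pos target_pos by (intro divide_nonneg_pos) auto
  with diff show "\<beta> - saving / \<omega> \<le> expectation (\<lambda>x. r x * c x) / expectation c"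
    unfolding \<phi>_def by linarith
  have "expectation (\<lambda>x. r x * c x) / \<phi> = \<beta> - saving / \<omega> \<longleftrightarrow>
      (waste c * \<omega> + saving * (\<phi> - \<omega>)) / (\<phi> * \<omega>) = 0"
    using diff by auto
  also have "\<dots> \<longleftrightarrow> waste c * \<omega> + saving * (\<phi> - \<omega>) = 0"
    using pos target_pos by auto
  also have "\<dots> \<longleftrightarrow> waste c = 0 \<and> (saving = 0 \<or> \<phi> = \<omega>)"
    using add_nonneg_eq_0_iff[OF w s] target_pos by auto
  finally show "expectation (\<lambda>x. r x * c x) / expectation c = \<beta> - saving / \<omega> \<longleftrightarrow>
      waste c = 0 \<and> (saving = 0 \<or> expectation c = \<omega>)"
    unfolding \<phi>_def .
qed

section \<open>Attainment of the bound and minimizers\<close>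

text \<open>Select everything below the threshold, nothing above it, and a constant fraction
  \<open>t\<close> of the level set. The two mass bounds are what places \<open>t\<close> in the
  unit interval.\<close>

lemma equations_solvable:
  obtains c where "selection_function M c" "equations c"
proof -
  have upto: "prob {x \<in> space M. r x \<le> \<beta>} = prob lower + prob level"
    by (subst finite_measure_Union[symmetric]) (auto intro!: arg_cong[where f = prob])
  \<comment> \<open>When \<open>prob level = 0\<close> the division gives \<open>0\<close>, which is then the right value.\<close>
  define t where "t = (\<omega> - prob lower) / prob level"
  have t: "0 \<le> t" "t \<le> 1"
    using mass_below_le mass_upto_ge upto measure_nonneg[of M level]
    by (auto simp: t_def field_simps divide_le_eq_1)
  \<comment> \<open>If the level set is null, the mass bounds squeeze \<open>prob lower\<close> to
    \<open>\<omega>\<close>, and both sides are zero.\<close>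
  have t_level: "t * prob level = \<omega> - prob lower"
    using mass_below_le mass_upto_ge upto by (cases "prob level = 0") (auto simp: t_def)
  define c where "c x = indicator lower x + t * indicator level x" for x
  have "selection_function M c"
    unfolding selection_function_def
  proof (intro conjI ballI)
    show "c \<in> borel_measurable M" unfolding c_def[abs_def] by measurable
  qed (use t in \<open>auto simp: c_def indicator_def\<close>)
  moreover have "equations c"
  proof -
    have "(LINT x:lower|M. c x) = (LINT x|M. indicator lower x)"
      "(LINT x:level|M. c x) = (LINT x|M. t * indicator level x)"
      "(LINT x:upper|M. c x) = (LINT x|M. 0)"
      unfolding set_lebesgue_integral_def c_def
      by (intro Bochner_Integration.integral_cong; auto simp: indicator_def)+
    then show ?thesis using t_level by (simp add: equations_def)
  qed
  ultimately show ?thesis using that by blast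
qed

text \<open>Zero waste and coverage exactly \<open>\<omega>\<close> give equality in the bound,
  whatever the value of \<open>saving\<close>.\<close>

lemma equations_imp_arg_min:
  assumes c: "selection_function M c" and eq: "equations c"
  shows "is_arg_min (\<lambda>c. expectation (\<lambda>x. r x * c x) / expectation c)
    (\<lambda>c. selection_function M c \<and> \<omega> \<le> expectation c) c"
proof -
  from eq c have cov: "expectation c = \<omega>" and "waste c = 0" by (auto simp: equations_iff)
  then have "expectation (\<lambda>x. r x * c x) / expectation c = \<beta> - saving / \<omega>"
    using risk_ratio_ge(2)[OF c] by simp
  then show ?thesis
    using c cov risk_ratio_ge(1) by (auto simp: is_arg_min_linorder)
qed

text \<open>Comparison with a solution \<open>d\<close> of the equations shows that a minimizer
  attains the bound, so its waste is zero. It remains to exclude excess coverage, which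
  \<open>alt\<close> does when \<open>saving\<close> vanishes.\<close>

lemma arg_min_imp_equations:
  assumes opt: "is_arg_min (\<lambda>c. expectation (\<lambda>x. r x * c x) / expectation c)
      (\<lambda>c. selection_function M c \<and> \<omega> \<le> expectation c) c"
    and alt: "0 < prob lower \<or> prob level \<le> \<omega>"
  shows "equations c"
proof -
  from opt have c: "selection_function M c" and cov: "\<omega> \<le> expectation c"
    by (auto simp: is_arg_min_def)
  obtain d where d: "selection_function M d" "equations d" by (rule equations_solvable)
  then have covd: "expectation d = \<omega>" and "waste d = 0" by (auto simp: equations_iff)
  then have "expectation (\<lambda>x. r x * d x) / expectation d = \<beta> - saving / \<omega>"
    using risk_ratio_ge(2)[OF d(1)] by simp
  then have "expectation (\<lambda>x. r x * c x) / expectation c = \<beta> - saving / \<omega>"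
    using opt d(1) covd risk_ratio_ge(1)[OF c cov] by (force simp: is_arg_min_linorder)
  with risk_ratio_ge(2)[OF c cov]
  have w: "waste c = 0" and s: "saving = 0 \<or> expectation c = \<omega>" by auto
  have "expectation c = \<omega>"
  \<comment> \<open>With zero saving, \<open>lower\<close> is null, so \<open>alt\<close> leaves
    \<open>prob level \<le> \<omega>\<close>. Zero waste then puts \<open>c\<close> almost surely
    below the indicator of \<open>level\<close>, which caps its coverage at
    \<open>\<omega>\<close>.\<close>
  proof (cases "saving = 0")
    case True
    then have b0: "prob lower = 0" by (simp add: saving_eq_0_iff)
    then have level: "prob level \<le> \<omega>" using alt by simp
    have "AE x in M. x \<notin> lower"
      by (subst AE_iff_null_sets[symmetric]) (auto simp: null_sets_def emeasure_eq_measure b0)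
    moreover have "AE x in M. (r x < \<beta> \<longrightarrow> c x = 1) \<and> (r x > \<beta> \<longrightarrow> c x = 0)"
      using w waste_eq_0_iff[OF c] by simp
    ultimately have "AE x in M. c x \<le> indicator level x"
      using AE_space
    proof eventually_elim
      case (elim x)
      moreover have "c x \<le> 1" using c elim by (simp add: selection_function_def)
      ultimately show ?case by (cases "r x" \<beta> rule: linorder_cases) auto
    qed
    then have "expectation c \<le> expectation (indicator level :: 'a \<Rightarrow> real)"
      using integrable_selection[OF c] by (intro integral_mono_AE) (auto simp: emeasure_eq_measure)
    then show ?thesis using level cov by simp
  next
    case False
    then show ?thesis using s by simp
  qed
  then show ?thesis using w by (simp add: equations_iff[OF c])
qed

end

section \<open>From densities to the probability measure on inputs\<close>

lemma measurable_label_section: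
  assumes "(\<lambda>(x, y). f x y) \<in> borel_measurable (M \<Otimes>\<^sub>M count_space UNIV)"
  shows "(\<lambda>x. f x y) \<in> borel_measurable M"
  using measurable_compose[OF measurable_Pair2' assms, of y] by simp

text \<open>Tonelli: summing over labels is integration against counting measure, so the marginal
  has the same total mass as the joint density.\<close>

lemma prob_space_marginal:
  fixes p :: "'x \<Rightarrow> 'y::finite \<Rightarrow> real"
  assumes "joint_density M p"
  shows "prob_space (density M (\<lambda>x. ennreal (marginal p x)))"
proof
  \<comment> \<open>Provides the iterated integral \<open>nn_integral_fst\<close>.\<close>
  interpret sigma_finite_measure "count_space (UNIV :: 'y set)"
    by (rule sigma_finite_measure_count_space_finite) simp
  have meas [measurable]: "(\<lambda>(x, y). p x y) \<in> borel_measurable (M \<Otimes>\<^sub>M count_space UNIV)"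
    and nonneg: "\<And>x y. x \<in> space M \<Longrightarrow> 0 \<le> p x y"
    and prob: "prob_space (density (M \<Otimes>\<^sub>M count_space UNIV) (\<lambda>(x, y). ennreal (p x y)))"
    using assms by (auto simp: joint_density_def)
  have [measurable]: "(\<lambda>x. p x y) \<in> borel_measurable M" for y
    by (rule measurable_label_section[OF meas])
  have meas': "(\<lambda>(x, y). ennreal (p x y)) \<in> borel_measurable (M \<Otimes>\<^sub>M count_space UNIV)"
    by measurable
  have "emeasure (density M (\<lambda>x. ennreal (marginal p x))) (space M) =
      (\<integral>\<^sup>+ x. ennreal (marginal p x) \<partial>M)"
    by (subst emeasure_density)
      (auto simp: marginal_def intro!: nn_integral_cong)
  also have "\<dots> = (\<integral>\<^sup>+ x. \<integral>\<^sup>+ y. ennreal (p x y) \<partial>count_space UNIV \<partial>M)"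
    using nonneg
    by (intro nn_integral_cong) (simp add: marginal_def nn_integral_count_space_finite)
  also have "\<dots> = (\<integral>\<^sup>+ z. (case z of (x, y) \<Rightarrow> ennreal (p x y)) \<partial>(M \<Otimes>\<^sub>M count_space UNIV))"
    using nn_integral_fst[OF meas'] by simp
  also have "\<dots> = emeasure (density (M \<Otimes>\<^sub>M count_space UNIV) (\<lambda>(x, y). ennreal (p x y)))
      (space (M \<Otimes>\<^sub>M count_space UNIV))"
    using meas' by (subst emeasure_density) (auto intro!: nn_integral_cong)
  also have "\<dots> = 1"
    using prob_space.emeasure_space_1[OF prob] by simp
  finally show "emeasure (density M (\<lambda>x. ennreal (marginal p x)))
      (space (density M (\<lambda>x. ennreal (marginal p x)))) = 1"
    by simp
qed

text \<open>The converse is guarded: if \<open>lower\<close> is null and the level set has mass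
  above \<open>\<omega>\<close>, the indicator of the level set is optimal, yet its coverage exceeds
  \<open>\<omega>\<close>.\<close>

theorem theorem5:
  fixes M :: "'x measure" and p q :: "'x \<Rightarrow> 'y::finite \<Rightarrow> real"
    and l :: "'y \<Rightarrow> 'y \<Rightarrow> real" and h :: "'x \<Rightarrow> 'y"
    and r cs :: "'x \<Rightarrow> real" and \<omega> \<beta> :: real
  assumes "joint_density M p"
    and "conditional_distribution M p q"
    and "\<And>y y'. 0 \<le> l y y'"
    and "h \<in> M \<rightarrow>\<^sub>M count_space UNIV"
    and "r = conditional_risk q l h"
    and "0 < \<omega>" and "\<omega> \<le> 1"
    and "\<exists>c. optimal_selection M p l h \<omega> c"
    and "\<beta> = risk_threshold M p r \<omega>"
    and "selection_function M cs"
  shows "(threshold_equations M p r \<omega> \<beta> cs \<longrightarrow> optimal_selection M p l h \<omega> cs) \<and>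
    ((LINT x:{x \<in> space M. r x < \<beta>}|M. marginal p x) > 0 \<or>
     (LINT x:{x \<in> space M. r x = \<beta>}|M. marginal p x) \<le> \<omega> \<longrightarrow>
       (optimal_selection M p l h \<omega> cs \<longleftrightarrow> threshold_equations M p r \<omega> \<beta> cs))"
proof -
  define P where "P = density M (\<lambda>x. ennreal (marginal p x))"
  interpret P: prob_space P
    unfolding P_def by (rule prob_space_marginal[OF assms(1)])
  have sP: "space P = space M" and setsP [measurable_cong]: "sets P = sets M"
    by (simp_all add: P_def)
  have [measurable]: "(\<lambda>x. p x y) \<in> borel_measurable M" for y
    by (rule measurable_label_section) (use assms(1) in \<open>simp add: joint_density_def\<close>)
  have [measurable]: "(\<lambda>x. q x y) \<in> borel_measurable M" for y
    by (rule measurable_label_section) (use assms(2) in \<open>simp add: conditional_distribution_def\<close>)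
  have [measurable]: "marginal p \<in> borel_measurable M"
    unfolding marginal_def[abs_def] by measurable
  have pos: "0 \<le> marginal p x" if "x \<in> space M" for x
    using that assms(1) by (auto simp: marginal_def joint_density_def intro!: sum_nonneg)
  have q: "0 \<le> q x y" "(\<Sum>y\<in>UNIV. q x y) = 1" "p x y = marginal p x * q x y"
    if "x \<in> space M" for x y
    using that assms(2) by (auto simp: conditional_distribution_def)
  have [measurable]: "(\<lambda>x. l y (h x)) \<in> borel_measurable M" for y
    by (rule measurable_compose[OF assms(4)]) simp
  have [measurable]: "r \<in> borel_measurable M"
    unfolding assms(5) conditional_risk_def[abs_def] by measurable
  \<comment> \<open>Losses are nonnegative, so their total dominates each of them, and hence also
    every average \<open>r x\<close>.\<close>
  define B where "B = (\<Sum>y\<in>UNIV. \<Sum>y'\<in>UNIV. l y y')"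
  have rB: "0 \<le> r x \<and> r x \<le> B" if x: "x \<in> space M" for x
  proof -
    have "l y (h x) \<le> B" for y
    proof -
      have "l y (h x) \<le> (\<Sum>y'\<in>UNIV. l y y')"
        using assms(3) by (intro member_le_sum) auto
      also have "\<dots> \<le> B"
        unfolding B_def using assms(3) by (intro member_le_sum sum_nonneg) auto
      finally show ?thesis .
    qed
    then have "r x \<le> (\<Sum>y\<in>UNIV. q x y * B)"
      unfolding assms(5) conditional_risk_def using q[OF x] by (intro sum_mono mult_left_mono) auto
    also have "\<dots> = B" using q[OF x] by (simp flip: sum_distrib_right)
    finally show ?thesis
      using q[OF x] assms(3) by (auto simp: assms(5) conditional_risk_def intro!: sum_nonneg)
  qed
  have lint: "(LINT x|P. f x) = (LINT x|M. marginal p x * f x)"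
    if "f \<in> borel_measurable M" for f :: "'x \<Rightarrow> real"
    unfolding P_def using that pos by (subst integral_density) auto
  have slint: "(LINT x:A|M. marginal p x * f x) = (LINT x:A|P. f x)"
    if [measurable]: "f \<in> borel_measurable M" "A \<in> sets M" for f :: "'x \<Rightarrow> real" and A
    unfolding set_lebesgue_integral_def by (subst lint) (auto simp: mult_ac)
  have mass: "(LINT x:A|M. marginal p x) = P.prob A" if "A \<in> sets M" for A
    using slint[of "\<lambda>_. 1" A] that by (simp add: set_lebesgue_integral_def setsP)
  have \<beta>: "\<beta> = Inf {a. \<omega> \<le> P.prob {x \<in> space P. r x < a}}"
    unfolding assms(9) risk_threshold_def sP by (subst mass) auto
  have "r \<in> borel_measurable P" by measurable
  note quantile = P.quantile_threshold[OF this, of 0 B, unfolded sP, OF rB assms(6,7), folded sP, OF _ \<beta>]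
  interpret T: selection_threshold P r \<omega> \<beta>
  proof
    show "integrable P r"
      using rB by (intro P.integrable_const_bound[of _ B]) (auto simp: sP)
  qed (use quantile assms(6) sP in auto)
  have sel: "selection_function M c \<longleftrightarrow> selection_function P c" for c
    by (simp add: selection_function_def sP measurable_cong_sets[OF setsP refl])
  have cov: "coverage M p c = P.expectation c" if "selection_function M c" for c
    using that by (simp add: coverage_def lint selection_function_def)
  have risk: "selective_risk M p l h c = P.expectation (\<lambda>x. r x * c x) / P.expectation c"
    if c: "selection_function M c" for c
  proof -
    have [measurable]: "c \<in> borel_measurable M" using c by (simp add: selection_function_def)
    \<comment> \<open>Factoring \<open>p x y\<close> through \<open>q\<close> holds at every point
      of the space, so any version of the conditional distribution yields the same
      numerator.\<close>
    have "(LINT x|M. (\<Sum>y\<in>UNIV. p x y * l y (h x) * c x)) = (LINT x|M. marginal p x * (r x * c x))"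
      using q(3) by (intro Bochner_Integration.integral_cong)
        (auto simp: assms(5) conditional_risk_def sum_distrib_left sum_distrib_right mult_ac)
    then show ?thesis using c by (simp add: selective_risk_def cov lint)
  qed
  \<comment> \<open>The two objectives are known to agree only on selection functions; this
    suffices, since \<open>is_arg_min\<close> compares feasible points only.\<close>
  have opt: "optimal_selection M p l h \<omega> cs \<longleftrightarrow>
      is_arg_min (\<lambda>c. P.expectation (\<lambda>x. r x * c x) / P.expectation c)
        (\<lambda>c. selection_function P c \<and> \<omega> \<le> P.expectation c) cs"
    unfolding optimal_selection_def is_arg_min_def feasible_def
    by (auto simp: cov risk simp flip: sel)
  have eqs: "threshold_equations M p r \<omega> \<beta> cs \<longleftrightarrow> T.equations cs"
    using assms(10) unfolding threshold_equations_def T.equations_def selection_function_def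
    by (simp add: slint mass sP)
  have mass': "(LINT x:{x \<in> space M. r x < \<beta>}|M. marginal p x) = P.prob T.lower"
    "(LINT x:{x \<in> space M. r x = \<beta>}|M. marginal p x) = P.prob T.level"
    by (simp_all add: mass sP)
  show ?thesis
    unfolding opt eqs mass'
    using T.equations_imp_arg_min T.arg_min_imp_equations assms(10) sel by blast
qed

end
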